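(* Any two uniformly symmetric circle endomorphisms $f$ and $g$ of the same degree $d\ge2$ are topologically conjugate (that is, $f\circ h=h\circ g$ for some circle homeomorphism $h$), and the conjugacy is a quasisymmetric homeomorphism.
   Context: $T$ is the unit circle in $\mathbb{C}$. A circle endomorphism is an orientation-preserving covering map $f:T\to T$ of degree $d\ge2$ with $f(1)=1$; its lift is the homeomorphism $F:\mathbb{R}\to\mathbb{R}$ with $F(0)=0$, $F(x+1)=F(x)+d$ and $e^{2\pi i F(x)}=f(e^{2\pi i x})$. A circle homeomorphism is an orientation-preserving homeomorphism $h$ of $T$; its lift is the homeomorphism $H:\mathbb{R}\to\mathbb{R}$ with $H(x+1)=H(x)+1$, $0\le H(0)<1$ and $e^{2\pi i H(x)}=h(e^{2\pi i x})$. $f$ is uniformly symmetric if there is a bounded function $\varepsilon(t)>0$, $t>0$, with $\varepsilon(t)\to0$ as $t\to0^{+}$, such that $$\frac{1}{1+\varepsilon(t)}\le\frac{|F^{-n}(x+t)-F^{-n}(x)|}{|F^{-n}(x)-F^{-n}(x-t)|}\le 1+\varepsilon(t)$$ for all $x\in\mathbb{R}$, $t>0$ and $n>0$. $h$ is quasisymmetric if there is $M\ge1$ with $M^{-1}\le\frac{|H(x+t)-H(x)|}{|H(x)-H(x-t)|}\le M$ for all $x\in\mathbb{R}$, $t>0$. Two circle endomorphisms $f,g$ are topologically conjugate if there is an orientation-preserving circle homeomorphism $h$ with $f\circ h=h\circ g$. *)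

theory Defs
  imports "HOL-Analysis.Analysis"
begin

abbreviation circle :: "complex set" where
  "circle \<equiv> sphere 0 1"

text \<open>Circle maps are functions on \<^typ>\<open>complex\<close>; only their values on \<^const>\<open>circle\<close> matter.
  Note that \<^term>\<open>cis (2 * pi * x)\<close> is $e^{2\pi i x}$.\<close>

definition circle_lift :: "(real \<Rightarrow> real) \<Rightarrow> (complex \<Rightarrow> complex) \<Rightarrow> bool" where
  "circle_lift F f \<longleftrightarrow>
     continuous_on UNIV F \<and> (\<forall>x. cis (2 * pi * F x) = f (cis (2 * pi * x)))"

definition circle_degree :: "(complex \<Rightarrow> complex) \<Rightarrow> int \<Rightarrow> bool" where
  "circle_degree f k \<longleftrightarrow> (\<exists>F. circle_lift F f \<and> (\<forall>x. F (x + 1) = F x + of_int k))"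

definition orientation_preserving :: "(complex \<Rightarrow> complex) \<Rightarrow> bool" where
  "orientation_preserving f \<longleftrightarrow> (\<exists>F. circle_lift F f \<and> strict_mono F)"

definition circle_endomorphism :: "nat \<Rightarrow> (complex \<Rightarrow> complex) \<Rightarrow> bool" where
  "circle_endomorphism d f \<longleftrightarrow>
     2 \<le> d \<and> covering_space circle f circle \<and> orientation_preserving f \<and>
     circle_degree f (int d) \<and> f 1 = 1"

definition endomorphism_lift :: "nat \<Rightarrow> (complex \<Rightarrow> complex) \<Rightarrow> (real \<Rightarrow> real) \<Rightarrow> bool" where
  "endomorphism_lift d f F \<longleftrightarrow>
     (\<exists>G. homeomorphism UNIV UNIV F G) \<and> F 0 = 0 \<and> (\<forall>x. F (x + 1) = F x + real d) \<and>
     (\<forall>x. cis (2 * pi * F x) = f (cis (2 * pi * x)))"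

definition circle_homeomorphism :: "(complex \<Rightarrow> complex) \<Rightarrow> bool" where
  "circle_homeomorphism h \<longleftrightarrow>
     (\<exists>k. homeomorphism circle circle h k) \<and> orientation_preserving h"

definition homeomorphism_lift :: "(complex \<Rightarrow> complex) \<Rightarrow> (real \<Rightarrow> real) \<Rightarrow> bool" where
  "homeomorphism_lift h H \<longleftrightarrow>
     (\<exists>K. homeomorphism UNIV UNIV H K) \<and> 0 \<le> H 0 \<and> H 0 < 1 \<and> (\<forall>x. H (x + 1) = H x + 1) \<and>
     (\<forall>x. cis (2 * pi * H x) = h (cis (2 * pi * x)))"

text \<open>The lifts in the next two definitions exist and are unique; see
  \<open>endomorphism_lift_ex1\<close> and \<open>homeomorphism_lift_ex1\<close> below.\<close>

definition uniformly_symmetric :: "nat \<Rightarrow> (complex \<Rightarrow> complex) \<Rightarrow> bool" where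
  "uniformly_symmetric d f \<longleftrightarrow>
     (\<exists>F. endomorphism_lift d f F \<and>
       (\<exists>\<epsilon> :: real \<Rightarrow> real.
          (\<forall>t>0. \<epsilon> t > 0) \<and> bounded (\<epsilon> ` {0<..}) \<and> (\<epsilon> \<longlongrightarrow> 0) (at_right 0) \<and>
          (\<forall>x. \<forall>t>0. \<forall>n>0.
             (let R = (inv F ^^ n) in
              1 / (1 + \<epsilon> t) \<le> \<bar>R (x + t) - R x\<bar> / \<bar>R x - R (x - t)\<bar> \<and>
              \<bar>R (x + t) - R x\<bar> / \<bar>R x - R (x - t)\<bar> \<le> 1 + \<epsilon> t))))"

definition quasisymmetric :: "(complex \<Rightarrow> complex) \<Rightarrow> bool" where
  "quasisymmetric h \<longleftrightarrow>
     circle_homeomorphism h \<and>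
     (\<exists>H. homeomorphism_lift h H \<and>
       (\<exists>M\<ge>1. \<forall>x. \<forall>t>0.
          inverse M \<le> \<bar>H (x + t) - H x\<bar> / \<bar>H x - H (x - t)\<bar> \<and>
          \<bar>H (x + t) - H x\<bar> / \<bar>H x - H (x - t)\<bar> \<le> M))"

definition conjugacy :: "(complex \<Rightarrow> complex) \<Rightarrow> (complex \<Rightarrow> complex) \<Rightarrow> (complex \<Rightarrow> complex) \<Rightarrow> bool" where
  "conjugacy h f g \<longleftrightarrow> circle_homeomorphism h \<and> (\<forall>z\<in>circle. f (h z) = h (g z))"

definition topologically_conjugate :: "(complex \<Rightarrow> complex) \<Rightarrow> (complex \<Rightarrow> complex) \<Rightarrow> bool" where
  "topologically_conjugate f g \<longleftrightarrow> (\<exists>h. conjugacy h f g)"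


lemma cis_2pi_eq_iff: "cis (2 * pi * x) = cis (2 * pi * y) \<longleftrightarrow> x - y \<in> \<int>"
proof -
  have "cis (2 * pi * x) = cis (2 * pi * y) \<longleftrightarrow> cis (2 * pi * (x - y)) = 1"
    by (simp add: right_diff_distrib flip: cis_divide)
  also have "\<dots> \<longleftrightarrow> cos (2 * pi * (x - y)) = 1"
    by (metis cis.sel(1) complex_eqI cis.sel(2) cos_one_sin_zero one_complex.sel)
  also have "\<dots> \<longleftrightarrow> x - y \<in> \<int>"
    by (auto simp: cos_one_2pi_int Ints_def)
  finally show ?thesis .
qed

lemma lifts_differ_by_int:
  assumes "circle_lift F f" "circle_lift G f"
  obtains m :: int where "\<And>x. F x = G x + of_int m"
proof -
  have Z: "F x - G x \<in> \<int>" for x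
    using assms by (simp add: circle_lift_def flip: cis_2pi_eq_iff)
  have "(\<lambda>x. F x - G x) constant_on UNIV"
  proof (rule continuous_discrete_range_constant)
    show "continuous_on UNIV (\<lambda>x. F x - G x)"
      using assms by (auto simp: circle_lift_def intro: continuous_on_diff)
    show "\<exists>e>0. \<forall>y. y \<in> UNIV \<and> F y - G y \<noteq> F x - G x \<longrightarrow> e \<le> norm (F y - G y - (F x - G x))" for x
      using Ints_nonzero_abs_ge1[OF Ints_diff[OF Z Z]] by (intro exI[of _ 1]) auto
  qed auto
  then obtain c where c: "\<And>x. F x - G x = c"
    by (auto simp: constant_on_def)
  with Z[of 0] obtain m where "c = of_int m"
    by (auto elim: Ints_cases)
  with c show ?thesis
    by (intro that[of m]) (simp add: algebra_simps)
qed

lemma real_homeomorphism_of_quasiperiodic: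
  fixes F :: "real \<Rightarrow> real"
  assumes "continuous_on UNIV F" "strict_mono F" "\<And>x. F (x + 1) = F x + c"
  shows "\<exists>G. homeomorphism UNIV UNIV F G"
proof -
  have c: "c > 0"
    using strict_monoD[OF assms(2), of 0 1] assms(3)[of 0] by simp
  have up: "F (real n) = F 0 + real n * c" for n
  proof (induction n)
    case (Suc n)
    then show ?case
      using assms(3)[of "real n"] by (simp add: algebra_simps)
  qed auto
  have dn: "F (- real n) = F 0 - real n * c" for n
  proof (induction n)
    case (Suc n)
    have "F (- real (Suc n) + 1) = F (- real (Suc n)) + c"
      by (rule assms)
    with Suc show ?case
      by (simp add: algebra_simps)
  qed auto
  have "\<exists>x. F x = y" for y
  proof -
    obtain n :: nat where n: "\<bar>y - F 0\<bar> / c < real n"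
      using reals_Archimedean2 by blast
    then have "\<bar>y - F 0\<bar> < real n * c"
      using c by (simp add: field_simps)
    then have "F (- real n) \<le> y" "y \<le> F (real n)"
      by (auto simp: up dn)
    then show ?thesis
      using IVT'[of F "- real n" y "real n"] continuous_on_subset[OF assms(1)] by auto
  qed
  then have surj: "F ` UNIV = UNIV"
    by (metis surj_def)
  have inj: "inj F"
    by (rule strict_mono_imp_inj_on[OF assms(2)])
  have "open (F ` U)" if "open U" for U
    using that by (intro injective_into_1d_imp_open_map_UNIV continuous_on_subset[OF assms(1)]
      inj_on_subset[OF inj]) auto
  then show ?thesis
    using homeomorphism_injective_open_map[OF assms(1) surj inj] by auto
qed

lemma endomorphism_lift_ex1:
  assumes "circle_endomorphism d f"
  shows "\<exists>!F. endomorphism_lift d f F"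
proof (rule ex_ex1I)
  obtain A where A: "circle_lift A f" "strict_mono A"
    using assms by (auto simp: circle_endomorphism_def orientation_preserving_def)
  obtain B where B: "circle_lift B f" "\<And>x. B (x + 1) = B x + real d"
    using assms by (auto simp: circle_endomorphism_def circle_degree_def)
  obtain m where m: "\<And>x. A x = B x + of_int m"
    using lifts_differ_by_int[OF A(1) B(1)] by blast
  have "cis (2 * pi * A 0) = cis (2 * pi * 0)"
    using A assms by (auto simp: circle_lift_def circle_endomorphism_def)
  then have A0: "A 0 \<in> \<int>"
    by (simp only: cis_2pi_eq_iff) simp
  define F where "F = (\<lambda>x. A x - A 0)"
  have per: "F (x + 1) = F x + real d" for x
    by (simp add: F_def m B)
  have "\<exists>G. homeomorphism UNIV UNIV F G"
    using A per by (intro real_homeomorphism_of_quasiperiodic)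
      (auto simp: F_def circle_lift_def strict_mono_def intro!: continuous_intros)
  moreover have "cis (2 * pi * F x) = f (cis (2 * pi * x))" for x
  proof -
    have "cis (2 * pi * F x) = cis (2 * pi * A x)"
      unfolding cis_2pi_eq_iff using A0 by (simp add: F_def)
    then show ?thesis
      using A by (simp add: circle_lift_def)
  qed
  ultimately show "\<exists>F. endomorphism_lift d f F"
    using per by (intro exI[of _ F]) (simp add: endomorphism_lift_def F_def)
next
  fix F G
  assume *: "endomorphism_lift d f F" "endomorphism_lift d f G"
  then obtain m :: int where "\<And>x. F x = G x + of_int m"
    using lifts_differ_by_int[of F f G]
    by (force simp: endomorphism_lift_def circle_lift_def homeomorphism_def)
  moreover from this[of 0] * have "m = 0"
    by (simp add: endomorphism_lift_def)
  ultimately show "F = G"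
    by auto
qed

lemma homeomorphism_lift_ex1:
  assumes "circle_homeomorphism h"
  shows "\<exists>!H. homeomorphism_lift h H"
proof (rule ex_ex1I)
  obtain A where A: "circle_lift A h" "strict_mono A"
    using assms by (auto simp: circle_homeomorphism_def orientation_preserving_def)
  have contA: "continuous_on S A" for S
    using A(1) continuous_on_subset by (auto simp: circle_lift_def)
  have inj: "inj_on h circle"
    using assms by (force simp: circle_homeomorphism_def homeomorphism_def intro: inj_on_inverseI)
  have diff: "x - y \<in> \<int>" if "A x - A y \<in> \<int>" for x y
  proof -
    have "h (cis (2 * pi * x)) = h (cis (2 * pi * y))"
      using that A by (simp add: circle_lift_def flip: cis_2pi_eq_iff)
    then show ?thesis
      using inj by (simp add: inj_on_def flip: cis_2pi_eq_iff)
  qed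
  have per: "A (x + 1) = A x + 1" for x
  proof -
    have "cis (2 * pi * (x + 1)) = cis (2 * pi * x)"
      unfolding cis_2pi_eq_iff by simp
    then have "cis (2 * pi * A (x + 1)) = cis (2 * pi * A x)"
      using A(1) by (simp add: circle_lift_def)
    then have "A (x + 1) - A x \<in> \<int>"
      by (simp only: cis_2pi_eq_iff)
    moreover have "A (x + 1) - A x > 0"
      using strict_monoD[OF A(2), of x "x + 1"] by simp
    ultimately have ge: "A x + 1 \<le> A (x + 1)"
      using Ints_nonzero_abs_ge1[of "A (x + 1) - A x"] by simp
    then obtain y where y: "x \<le> y" "y \<le> x + 1" "A y = A x + 1"
      using IVT'[of A x "A x + 1" "x + 1"] contA by auto
    then have "y - x \<in> \<int>" "y \<noteq> x"
      by (auto intro: diff)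
    then have "y = x + 1"
      using y Ints_nonzero_abs_ge1[of "y - x"] by simp
    with y show ?thesis by simp
  qed
  define H where "H = (\<lambda>x. A x - of_int \<lfloor>A 0\<rfloor>)"
  have "\<exists>G. homeomorphism UNIV UNIV H G"
    using A per by (intro real_homeomorphism_of_quasiperiodic[where c = 1])
      (auto simp: H_def circle_lift_def strict_mono_def intro!: continuous_intros)
  moreover have "cis (2 * pi * H x) = h (cis (2 * pi * x))" for x
  proof -
    have "cis (2 * pi * H x) = cis (2 * pi * A x)"
      unfolding cis_2pi_eq_iff by (simp add: H_def)
    then show ?thesis
      using A by (simp add: circle_lift_def)
  qed
  moreover have "0 \<le> H 0" "H 0 < 1"
    unfolding H_def by linarith+
  ultimately show "\<exists>H. homeomorphism_lift h H"
    by (intro exI[of _ H]) (simp add: homeomorphism_lift_def H_def per)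
next
  fix F G
  assume *: "homeomorphism_lift h F" "homeomorphism_lift h G"
  then obtain m :: int where "\<And>x. F x = G x + of_int m"
    using lifts_differ_by_int[of F h G]
    by (force simp: homeomorphism_lift_def circle_lift_def homeomorphism_def)
  moreover from this[of 0] * have "m = 0"
    by (simp add: homeomorphism_lift_def)
  ultimately show "F = G"
    by auto
qed

end

theory Submission
  imports Defs
begin

text \<open>Work with lifts \<open>F\<close>, \<open>G\<close> of \<open>f\<close>,
  \<open>g\<close>. The bound on \<open>\<epsilon>\<close> makes all inverse iterates
  \<open>F^-n\<close> quasisymmetric with one constant \<open>M\<close> that does not depend on
  \<open>n\<close>, and likewise for \<open>G\<close>; this uniformity carries both halves of the
  proof (\<open>uniformly_symmetric_expanding_lift\<close>).

  Existence (\<open>conjugating_lift_exists\<close>): \<open>F^-n\<close> maps intervals of length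
  \<open>d^n\<close> onto intervals of length 1, and halving an interval cuts its image by a factor
  of at most \<open>M / (1 + M)\<close>. Hence \<open>F^-n\<close> shrinks unit intervals
  geometrically. So \<open>F^-n o G^n\<close> converges uniformly to some \<open>H\<close> with
  \<open>F o H = H o G\<close> that commutes with translation by 1; since \<open>G\<close> expands,
  \<open>H\<close> is strictly increasing, and it descends to a circle homeomorphism.

  Quasisymmetry (\<open>conjugating_lift_quasisym\<close>): the lift \<open>H\<close> of any
  conjugacy satisfies \<open>F o H = H o G + m\<close> for an integer \<open>m\<close>. Magnify a
  short interval around \<open>x\<close> by \<open>G^n\<close> to unit scale, where periodicity and
  compactness bound the distortion of \<open>H\<close>, and return by \<open>F^-n\<close>. Both
  changes of scale cost constants that depend on neither \<open>n\<close> nor the interval. Long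
  intervals are handled by periodicity alone.\<close>

section \<open>Quasisymmetric maps of the line\<close>

definition quasisym_map :: "real \<Rightarrow> (real \<Rightarrow> real) \<Rightarrow> bool" where
  "quasisym_map M \<phi> \<longleftrightarrow> strict_mono \<phi> \<and>
     (\<forall>x. \<forall>t>0. \<phi> (x + t) - \<phi> x \<le> M * (\<phi> x - \<phi> (x - t)) \<and>
                \<phi> x - \<phi> (x - t) \<le> M * (\<phi> (x + t) - \<phi> x))"

lemma quasisym_mapD:
  assumes "quasisym_map M \<phi>" "t > 0"
  shows "\<phi> (x + t) - \<phi> x \<le> M * (\<phi> x - \<phi> (x - t))"
    and "\<phi> x - \<phi> (x - t) \<le> M * (\<phi> (x + t) - \<phi> x)"
  using assms by (auto simp: quasisym_map_def)

lemma quasisym_map_strict_mono: "quasisym_map M \<phi> \<Longrightarrow> strict_mono \<phi>"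
  by (simp add: quasisym_map_def)

text \<open>Reflection swaps the intervals to the left and right of a point, so every one-sided
  estimate below yields its mirror image.\<close>

lemma quasisym_map_reflect:
  assumes "quasisym_map M \<phi>"
  shows "quasisym_map M (\<lambda>x. - \<phi> (- x))"
  unfolding quasisym_map_def
proof (intro conjI allI impI)
  show "strict_mono (\<lambda>x. - \<phi> (- x))"
    using quasisym_map_strict_mono[OF assms] by (simp add: strict_mono_def)
next
  fix x t :: real
  assume "t > 0"
  from quasisym_mapD[OF assms this, of "- x"]
  show "- \<phi> (- (x + t)) - - \<phi> (- x) \<le> M * (- \<phi> (- x) - - \<phi> (- (x - t)))"
    and "- \<phi> (- x) - - \<phi> (- (x - t)) \<le> M * (- \<phi> (- (x + t)) - - \<phi> (- x))"
    by (simp_all add: minus_diff_commute)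
qed

lemma quasisym_map_pos:
  assumes "quasisym_map M \<phi>"
  shows "M > 0"
proof -
  note mono = strict_monoD[OF quasisym_map_strict_mono[OF assms]]
  have "0 < \<phi> 1 - \<phi> 0" "0 < \<phi> 0 - \<phi> (-1)"
    by (simp_all add: mono)
  moreover have "\<phi> 1 - \<phi> 0 \<le> M * (\<phi> 0 - \<phi> (-1))"
    using quasisym_mapD(1)[OF assms, of 1 0] by simp
  ultimately show ?thesis
    by (meson less_le_trans zero_less_mult_pos2)
qed

text \<open>Adjoining a neighbour of equal length multiplies the length of the image by at most
  \<open>1 + M\<close>.\<close>

lemma quasisym_map_double:
  assumes qs: "quasisym_map M \<phi>" and "t > 0"
  shows "\<phi> (x + 2 ^ k * t) - \<phi> x \<le> (1 + M) ^ k * (\<phi> (x + t) - \<phi> x)"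
proof (induction k)
  case (Suc k)
  let ?s = "2 ^ k * t"
  have "\<phi> (x + ?s + ?s) - \<phi> (x + ?s) \<le> M * (\<phi> (x + ?s) - \<phi> x)"
    using quasisym_mapD(1)[OF qs, of ?s "x + ?s"] \<open>t > 0\<close> by simp
  then have "\<phi> (x + 2 ^ Suc k * t) - \<phi> x \<le> (1 + M) * (\<phi> (x + ?s) - \<phi> x)"
    by (simp add: algebra_simps)
  also have "\<dots> \<le> (1 + M) * ((1 + M) ^ k * (\<phi> (x + t) - \<phi> x))"
    using Suc quasisym_map_pos[OF qs] by (intro mult_left_mono) auto
  finally show ?case
    by (simp add: mult.assoc)
qed auto

text \<open>The image of the left half is at most \<open>M\<close> times that of the right half,
  hence at most the fraction \<open>M / (1 + M)\<close> of the whole. That this fraction is below 1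
  is the source of all contraction.\<close>

lemma quasisym_map_halve:
  assumes qs: "quasisym_map M \<phi>" and "t > 0"
  shows "\<phi> (x + t) - \<phi> x \<le> (M / (1 + M)) ^ k * (\<phi> (x + 2 ^ k * t) - \<phi> x)"
proof (induction k)
  case (Suc k)
  let ?s = "2 ^ k * t"
  note M = quasisym_map_pos[OF qs]
  have "\<phi> (x + ?s) - \<phi> x \<le> M * (\<phi> (x + ?s + ?s) - \<phi> (x + ?s))"
    using quasisym_mapD(2)[OF qs, of ?s "x + ?s"] \<open>t > 0\<close> by simp
  then have "(1 + M) * (\<phi> (x + ?s) - \<phi> x) \<le> M * (\<phi> (x + 2 ^ Suc k * t) - \<phi> x)"
    by (simp add: algebra_simps)
  then have *: "\<phi> (x + ?s) - \<phi> x \<le> M / (1 + M) * (\<phi> (x + 2 ^ Suc k * t) - \<phi> x)"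
    using M by (simp add: field_simps)
  note Suc
  also have "(M / (1 + M)) ^ k * (\<phi> (x + ?s) - \<phi> x)
      \<le> (M / (1 + M)) ^ k * (M / (1 + M) * (\<phi> (x + 2 ^ Suc k * t) - \<phi> x))"
    using * M by (intro mult_left_mono) auto
  finally show ?case
    by (simp only: power_Suc2 mult.assoc)
qed auto

text \<open>Double \<open>q\<close> until it exceeds \<open>p\<close>, at cost
  \<open>(1 + M) ^ k\<close>, then cross \<open>x\<close> once, at cost \<open>M\<close>.\<close>

lemma quasisym_map_compare_right:
  assumes qs: "quasisym_map M \<phi>" and "0 < p" "0 < q" "p \<le> 2 ^ k * q"
  shows "\<phi> (x + p) - \<phi> x \<le> M * (1 + M) ^ k * (\<phi> x - \<phi> (x - q))"
proof -
  have "\<phi> (x + p) \<le> \<phi> (x + 2 ^ k * q)"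
    using assms by (simp add: strict_mono_less_eq[OF quasisym_map_strict_mono])
  then have "\<phi> (x + p) - \<phi> x \<le> (1 + M) ^ k * (\<phi> (x + q) - \<phi> x)"
    using quasisym_map_double[OF qs \<open>0 < q\<close>, of x k] by simp
  also have "\<dots> \<le> (1 + M) ^ k * (M * (\<phi> x - \<phi> (x - q)))"
    using quasisym_map_pos[OF qs] quasisym_mapD(1)[OF qs \<open>0 < q\<close>]
    by (intro mult_left_mono) auto
  finally show ?thesis
    by (simp add: ac_simps)
qed

lemma quasisym_map_compare_left:
  assumes "quasisym_map M \<phi>" "0 < p" "0 < q" "q \<le> 2 ^ k * p"
  shows "\<phi> x - \<phi> (x - q) \<le> M * (1 + M) ^ k * (\<phi> (x + p) - \<phi> x)"
  using quasisym_map_compare_right[OF quasisym_map_reflect[OF assms(1)] assms(3,2,4), of "- x"]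
  by (simp add: add.commute)

text \<open>A converse to the comparison: equal images force comparable intervals. Were
  \<open>q\<close> below \<open>p / 2 ^ k\<close>, then \<open>k\<close> halvings would make the
  left image smaller than the right one.\<close>

lemma quasisym_map_preimage_right:
  assumes qs: "quasisym_map M \<phi>" and "0 < p" "0 < q"
    and k: "M * (M / (1 + M)) ^ k \<le> 1"
    and eq: "\<phi> (x + p) - \<phi> x = \<phi> x - \<phi> (x - q)"
  shows "p \<le> 2 ^ k * q"
proof (rule ccontr)
  assume "\<not> p \<le> 2 ^ k * q"
  note mono = quasisym_map_strict_mono[OF qs] and M = quasisym_map_pos[OF qs]
  have "q < p / 2 ^ k"
    using \<open>\<not> p \<le> 2 ^ k * q\<close> by (simp add: field_simps)
  then have "\<phi> (x - p / 2 ^ k) < \<phi> (x - q)"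
    by (intro strict_monoD[OF mono]) auto
  then have "\<phi> x - \<phi> (x - q) < \<phi> x - \<phi> (x - p / 2 ^ k)"
    by simp
  \<comment> \<open>Halving keeps the left endpoint; the reflected map makes it keep the right
    endpoint \<open>x\<close>.\<close>
  also have "\<dots> \<le> (M / (1 + M)) ^ k * (\<phi> x - \<phi> (x - p))"
    using quasisym_map_halve[OF quasisym_map_reflect[OF qs], of "p / 2 ^ k" "- x" k] \<open>0 < p\<close>
    by simp
  also have "\<dots> \<le> (M / (1 + M)) ^ k * (M * (\<phi> (x + p) - \<phi> x))"
    using M quasisym_mapD(2)[OF qs \<open>0 < p\<close>] by (intro mult_left_mono) auto
  also have "\<dots> = M * (M / (1 + M)) ^ k * (\<phi> (x + p) - \<phi> x)"
    by simp
  also have "\<dots> \<le> \<phi> (x + p) - \<phi> x"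
    using k strict_monoD[OF mono, of x "x + p"] \<open>0 < p\<close> by (intro mult_left_le_one_le) (use M in auto)
  finally show False
    using eq by simp
qed

lemma quasisym_map_preimage_left:
  assumes "quasisym_map M \<phi>" "0 < p" "0 < q"
    and "M * (M / (1 + M)) ^ k \<le> 1"
    and "\<phi> (x + p) - \<phi> x = \<phi> x - \<phi> (x - q)"
  shows "q \<le> 2 ^ k * p"
  using quasisym_map_preimage_right[OF quasisym_map_reflect[OF assms(1)] assms(3,2,4), of "- x"] assms(5)
  by (simp add: add.commute)

section \<open>Quasiperiodic maps of the line\<close>

lemma quasiperiodic_of_int:
  fixes F :: "real \<Rightarrow> real"
  assumes "\<And>x. F (x + 1) = F x + c"
  shows "F (x + of_int k) = F x + of_int k * c"
proof (induction k rule: int_induct[where k = 0])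
  case (step1 i)
  then show ?case
    using assms[of "x + of_int i"] by (simp add: algebra_simps)
next
  case (step2 i)
  then show ?case
    using assms[of "x + of_int (i - 1)"] by (simp add: algebra_simps)
qed auto

lemma funpow_strict_mono: "strict_mono F \<Longrightarrow> strict_mono (F ^^ n)" for F :: "'a::order \<Rightarrow> 'a"
  by (induction n) (auto simp: strict_mono_def)

text \<open>The increment over length \<open>c\<close> is positive, continuous and 1-periodic in
  \<open>x\<close>, so its minimum over \<open>{0..1}\<close> serves; monotonicity covers longer
  steps.\<close>

lemma quasiperiodic_bounded_below:
  fixes H :: "real \<Rightarrow> real"
  assumes "continuous_on UNIV H" "strict_mono H" "\<And>x. H (x + 1) = H x + 1" "c > 0"
  obtains \<delta> where "\<delta> > 0" "\<And>x s. c \<le> s \<Longrightarrow> \<delta> \<le> H (x + s) - H x"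
proof -
  note H_int = quasiperiodic_of_int[of H 1, OF assms(3)]
  have "continuous_on {0..1} (\<lambda>x. H (x + c) - H x)"
    by (intro continuous_intros continuous_on_compose2[OF assms(1)]) auto
  then obtain z where z: "\<And>x. x \<in> {0..1} \<Longrightarrow> H (z + c) - H z \<le> H (x + c) - H x"
    using continuous_attains_inf[of "{0..1}" "\<lambda>x. H (x + c) - H x"] by fastforce
  show ?thesis
  proof
    show "H (z + c) - H z > 0"
      using strict_monoD[OF assms(2)] \<open>c > 0\<close> by simp
  next
    fix x s :: real
    assume "c \<le> s"
    define y where "y = x - of_int \<lfloor>x\<rfloor>"
    have "y \<in> {0..1}"
      unfolding y_def atLeastAtMost_iff by linarith
    then have "H (z + c) - H z \<le> H (y + c) - H y"
      by (rule z)
    also have "\<dots> = H (x + c) - H x"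
      using H_int[of y "\<lfloor>x\<rfloor>"] H_int[of "y + c" "\<lfloor>x\<rfloor>"] by (simp add: y_def)
    also have "\<dots> \<le> H (x + s) - H x"
      using strict_mono_less_eq[OF assms(2)] \<open>c \<le> s\<close> by simp
    finally show "H (z + c) - H z \<le> H (x + s) - H x" .
  qed
qed

section \<open>Lifts with uniformly quasisymmetric inverse iterates\<close>

text \<open>In \<open>qs\<close> the exponent \<open>n\<close> is universally quantified while
  \<open>M\<close> is fixed: one constant serves all inverse iterates.\<close>

locale expanding_lift =
  fixes F :: "real \<Rightarrow> real" and d :: nat and M :: real
  assumes degree: "2 \<le> d"
    and cont: "continuous_on UNIV F"
    and mono: "strict_mono F"
    and surj: "surj F"
    and zero: "F 0 = 0"
    and per: "F (x + 1) = F x + real d"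
    and qs: "quasisym_map M (inv F ^^ n)"
begin

lemma inj: "inj F"
  by (rule strict_mono_imp_inj_on[OF mono])

lemma inv_funpow [simp]: "(inv F ^^ n) ((F ^^ n) x) = x"
proof (induction n)
  case (Suc n)
  have "(inv F ^^ Suc n) ((F ^^ Suc n) x) = (inv F ^^ n) (inv F (F ((F ^^ n) x)))"
    by (subst funpow_Suc_right) simp
  then show ?case
    unfolding inv_f_f[OF inj] Suc .
qed auto

lemma funpow_inv [simp]: "(F ^^ n) ((inv F ^^ n) x) = x"
proof (induction n)
  case (Suc n)
  have "(F ^^ Suc n) ((inv F ^^ Suc n) x) = (F ^^ n) (F (inv F ((inv F ^^ n) x)))"
    by (subst funpow_Suc_right) simp
  then show ?case
    unfolding surj_f_inv_f[OF surj] Suc .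
qed auto

lemma add_of_int: "F (x + of_int k) = F x + of_int k * real d"
  by (rule quasiperiodic_of_int) (rule per)

lemma of_int: "F (of_int k) = of_int k * real d"
  using add_of_int[of 0 k] zero by simp

lemma funpow_add_1: "(F ^^ n) (x + 1) = (F ^^ n) x + real d ^ n"
proof (induction n)
  case (Suc n)
  then show ?case
    using add_of_int[of "(F ^^ n) x" "int d ^ n"] by simp
qed auto

lemma inv_funpow_add: "(inv F ^^ n) (x + real d ^ n) = (inv F ^^ n) x + 1"
  by (metis funpow_add_1 funpow_inv inv_funpow)

lemma M_pos: "M > 0"
  using quasisym_map_pos[OF qs] .

text \<open>A unit interval can be doubled \<open>n\<close> times inside an interval of length \<open>d\<^sup>n\<close>, whose image
  under \<open>F\<^sup>-\<^sup>n\<close> has length 1.\<close>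

lemma contraction:
  assumes "u \<le> v" "v \<le> u + 1"
  shows "(inv F ^^ n) v - (inv F ^^ n) u \<le> (M / (1 + M)) ^ n"
proof -
  note mono' = strict_mono_less_eq[OF quasisym_map_strict_mono[OF qs]]
  have "(inv F ^^ n) v - (inv F ^^ n) u \<le> (inv F ^^ n) (u + 1) - (inv F ^^ n) u"
    using assms by (simp add: mono')
  also have "\<dots> \<le> (M / (1 + M)) ^ n * ((inv F ^^ n) (u + 2 ^ n) - (inv F ^^ n) u)"
    using quasisym_map_halve[OF qs[of n], of 1 u n] by simp
  also have "\<dots> \<le> (M / (1 + M)) ^ n * 1"
  proof (intro mult_left_mono)
    have "(2::real) ^ n \<le> real d ^ n"
      using degree by (intro power_mono) auto
    then have "(inv F ^^ n) (u + 2 ^ n) \<le> (inv F ^^ n) (u + real d ^ n)"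
      by (simp add: mono')
    then show "(inv F ^^ n) (u + 2 ^ n) - (inv F ^^ n) u \<le> 1"
      by (simp add: inv_funpow_add)
  qed (use M_pos in auto)
  finally show ?thesis by simp
qed

text \<open>If the orbits of \<open>x\<close> and \<open>y\<close> stayed within distance 1,
  contraction would bound \<open>y - x\<close> by \<open>(M / (1 + M)) ^ n\<close> for every
  \<open>n\<close>.\<close>

lemma expansion:
  assumes "x < y"
  shows "\<exists>n. (F ^^ n) x + 1 \<le> (F ^^ n) y"
proof -
  have "M / (1 + M) < 1"
    using M_pos by simp
  then obtain n where n: "(M / (1 + M)) ^ n < y - x"
    using real_arch_pow_inv[of "y - x" "M / (1 + M)"] assms by auto
  have "\<not> (F ^^ n) y \<le> (F ^^ n) x + 1"
  proof
    assume "(F ^^ n) y \<le> (F ^^ n) x + 1"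
    moreover have "(F ^^ n) x \<le> (F ^^ n) y"
      using strict_mono_less_eq[OF funpow_strict_mono[OF mono]] assms by auto
    ultimately show False
      using contraction[of "(F ^^ n) x" "(F ^^ n) y" n] n by simp
  qed
  then show ?thesis
    by (intro exI[of _ n]) simp
qed

end

section \<open>Existence of a conjugating lift\<close>

text \<open>\<open>H\<close> is the limit of \<open>F\<^sup>-\<^sup>n \<circ> G\<^sup>n\<close>, whose consecutive terms differ by at most the length of a
  contracted unit interval. A limit of increasing maps is only weakly monotone; strictness comes from the expansion of \<open>G\<close>.\<close>

lemma conjugating_lift_exists:
  assumes "expanding_lift F d M" "expanding_lift G d N"
  obtains H where "continuous_on UNIV H" "strict_mono H" "\<And>x. H (x + 1) = H x + 1"
    "\<And>x. F (H x) = H (G x)"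
proof -
  interpret F: expanding_lift F d M by fact
  interpret G: expanding_lift G d N by fact
  define X where "X n x = (inv F ^^ n) ((G ^^ n) x)" for n x
  \<comment> \<open>The series telescopes from \<open>X 0 x = x\<close>, which lets the Weierstrass
    test give uniform convergence.\<close>
  define H where "H x = x + (\<Sum>n. X (Suc n) x - X n x)" for x
  \<comment> \<open>\<open>F^-1 o G\<close> fixes every integer, so it keeps each point inside its
    unit interval with integer endpoints.\<close>
  have near: "\<exists>u. u \<le> y \<and> y \<le> u + 1 \<and> u \<le> inv F (G y) \<and> inv F (G y) \<le> u + 1" for y
  proof -
    have mono_inv: "strict_mono (inv F)"
      using quasisym_map_strict_mono[OF F.qs[of 1]] by simp
    have inv_int: "inv F (of_int k * real d) = of_int k" for k
      using F.of_int[of k] F.inj by (metis inv_f_f)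
    let ?k = "\<lfloor>y\<rfloor>"
    have y: "of_int ?k \<le> y" "y \<le> of_int (?k + 1)"
      by linarith+
    then have "G (of_int ?k) \<le> G y" "G y \<le> G (of_int (?k + 1))"
      by (simp_all only: strict_mono_less_eq[OF G.mono])
    then have "inv F (of_int ?k * real d) \<le> inv F (G y)" "inv F (G y) \<le> inv F (of_int (?k + 1) * real d)"
      by (simp_all only: G.of_int strict_mono_less_eq[OF mono_inv])
    then show ?thesis
      using y unfolding inv_int by (intro exI[of _ "of_int ?k"]) simp
  qed
  have step: "\<bar>X (Suc n) x - X n x\<bar> \<le> (M / (1 + M)) ^ n" for n x
  proof -
    let ?y = "(G ^^ n) x"
    obtain u where u: "u \<le> ?y" "?y \<le> u + 1" "u \<le> inv F (G ?y)" "inv F (G ?y) \<le> u + 1"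
      using near by blast
    have "X (Suc n) x = (inv F ^^ n) (inv F (G ?y))"
      by (simp add: X_def funpow_swap1)
    moreover have "(inv F ^^ n) u \<le> (inv F ^^ n) w \<and> (inv F ^^ n) w \<le> (inv F ^^ n) (u + 1)"
      if "u \<le> w" "w \<le> u + 1" for w
      using that by (simp add: strict_mono_less_eq[OF quasisym_map_strict_mono[OF F.qs]])
    from this[OF u(1,2)] this[OF u(3,4)] F.contraction[of u "u + 1" n]
    have "\<bar>(inv F ^^ n) (inv F (G ?y)) - (inv F ^^ n) ?y\<bar> \<le> (M / (1 + M)) ^ n"
      by linarith
    ultimately show ?thesis
      by (simp add: X_def)
  qed
  have "uniform_limit UNIV (\<lambda>n x. \<Sum>i<n. X (Suc i) x - X i x)
          (\<lambda>x. \<Sum>i. X (Suc i) x - X i x) sequentially"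
    using step F.M_pos by (intro Weierstrass_m_test[where M = "\<lambda>n. (M / (1 + M)) ^ n"]) auto
  then have "uniform_limit UNIV (\<lambda>n x. x + (\<Sum>i<n. X (Suc i) x - X i x)) H sequentially"
    unfolding H_def by (intro uniform_limit_add uniform_limit_const)
  moreover have "x + (\<Sum>i<n. X (Suc i) x - X i x) = X n x" for n x
    by (simp add: sum_lessThan_telescope[of "\<lambda>i. X i x"]) (simp add: X_def)
  ultimately have unif: "uniform_limit UNIV X H sequentially"
    by simp
  then have lim: "(\<lambda>n. X n x) \<longlonglongrightarrow> H x" for x
    by (rule tendsto_uniform_limitI) auto
  have cont_inv: "continuous_on UNIV (inv F)"
  proof -
    have "open (F ` U)" if "open U" for U
      using that by (intro injective_into_1d_imp_open_map_UNIV continuous_on_subset[OF F.cont]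
        inj_on_subset[OF F.inj]) auto
    then obtain K where K: "homeomorphism UNIV UNIV F K"
      using homeomorphism_injective_open_map[OF F.cont F.surj F.inj] by auto
    then have "inv F = K"
      using F.inj by (metis UNIV_I homeomorphism_apply2 inv_f_f ext)
    with K show ?thesis
      by (simp add: homeomorphism_def)
  qed
  have "continuous_on UNIV (X n)" for n
  proof -
    have pow: "continuous_on UNIV (\<lambda>x. (f ^^ n) (h x))"
      if "continuous_on UNIV f" "continuous_on UNIV h" for f h :: "real \<Rightarrow> real"
      using that by (induction n) (auto intro: continuous_on_compose2)
    show ?thesis
      unfolding X_def by (intro pow cont_inv G.cont continuous_on_id)
  qed
  then have contH: "continuous_on UNIV H"
    by (intro uniform_limit_theorem[OF _ unif]) auto
  have perH: "H (x + 1) = H x + 1" for x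
  proof (rule LIMSEQ_unique)
    show "(\<lambda>n. X n (x + 1)) \<longlonglongrightarrow> H (x + 1)"
      by (rule lim)
    have "X n (x + 1) = X n x + 1" for n
      by (simp add: X_def G.funpow_add_1 F.inv_funpow_add)
    then show "(\<lambda>n. X n (x + 1)) \<longlonglongrightarrow> H x + 1"
      using lim by (auto intro: tendsto_intros)
  qed
  have conj: "F (H x) = H (G x)" for x
  proof (rule LIMSEQ_unique)
    \<comment> \<open>\<open>F\<close> cancels one inverse branch, and the freed iterate of
      \<open>G\<close> moves onto the argument.\<close>
    have "F (X (Suc n) x) = X n (G x)" for n
    proof -
      have "F (X (Suc n) x) = (inv F ^^ n) ((G ^^ Suc n) x)"
        by (simp add: X_def surj_f_inv_f[OF F.surj])
      then show ?thesis
        by (simp add: X_def funpow_swap1)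
    qed
    then show "(\<lambda>n. F (X (Suc n) x)) \<longlonglongrightarrow> H (G x)"
      using lim by simp
    show "(\<lambda>n. F (X (Suc n) x)) \<longlonglongrightarrow> F (H x)"
      using F.cont LIMSEQ_Suc[OF lim] by (intro continuous_on_tendsto_compose[OF F.cont]) auto
  qed
  have pow: "(F ^^ n) (H x) = H ((G ^^ n) x)" for n x
    by (induction n) (simp_all add: conj)
  have monoH: "H x \<le> H y" if "x \<le> y" for x y
    using lim lim
  proof (rule LIMSEQ_le)
    have "X n x \<le> X n y" for n
      using that by (simp add: X_def strict_mono_less_eq[OF quasisym_map_strict_mono[OF F.qs]]
          strict_mono_less_eq[OF funpow_strict_mono[OF G.mono]])
    then show "\<exists>N. \<forall>n\<ge>N. X n x \<le> X n y"
      by blast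
  qed
  have "H x < H y" if xy: "x < y" for x y
  proof -
    obtain n where "(G ^^ n) x + 1 \<le> (G ^^ n) y"
      using G.expansion[OF xy] by blast
    then have "H ((G ^^ n) x) + 1 \<le> H ((G ^^ n) y)"
      using monoH perH by metis
    then have "H x \<noteq> H y"
      by (auto simp flip: pow)
    then show ?thesis
      using monoH[of x y] xy by simp
  qed
  then have "strict_mono H"
    by (rule strict_monoI)
  from that[OF contH this perH conj] show ?thesis .
qed

section \<open>Quasisymmetry of conjugating lifts\<close>

text \<open>Iterate \<open>G\<close> until \<open>{x - t..x + t}\<close> has about unit size. Both halves then do, by the quasisymmetry of
  \<open>G\<^sup>-\<^sup>n\<close>; at that scale \<open>H\<close> distorts them boundedly, and \<open>F\<^sup>-\<^sup>n\<close> carries the picture back to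
  the original scale.\<close>

lemma conjugating_lift_quasisym:
  assumes "expanding_lift F d M" "expanding_lift G d N"
    and H: "continuous_on UNIV H" "strict_mono H" "\<And>x. H (x + 1) = H x + 1"
    and conj: "\<And>x. F (H x) = H (G x) + of_int m"
  shows "\<exists>K\<ge>1. quasisym_map K H"
proof -
  interpret F: expanding_lift F d M by fact
  interpret G: expanding_lift G d N by fact
  \<comment> \<open>Integer shifts accumulate under iteration, but each depends on \<open>n\<close>
    alone, so it cancels in differences.\<close>
  have "\<exists>k::int. \<forall>x. (F ^^ n) (H x) = H ((G ^^ n) x) + of_int k" for n
  proof (induction n)
    case (Suc n)
    then obtain k :: int where "\<And>x. (F ^^ n) (H x) = H ((G ^^ n) x) + of_int k"
      by blast
    then have "(F ^^ Suc n) (H x) = H ((G ^^ Suc n) x) + of_int (m + k * int d)" for x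
      by (simp add: F.add_of_int conj)
    then show ?case by blast
  qed (auto intro: exI[of _ 0])
  then obtain e :: "nat \<Rightarrow> int" where e: "\<And>n x. (F ^^ n) (H x) = H ((G ^^ n) x) + of_int (e n)"
    by metis
  have H_eq: "H x = (inv F ^^ n) (H ((G ^^ n) x) + of_int (e n))" for n x
    by (metis F.inv_funpow e)
  have "N / (1 + N) < 1"
    using G.M_pos by simp
  then obtain k where "(N / (1 + N)) ^ k < 1 / N"
    using real_arch_pow_inv[of "1 / N" "N / (1 + N)"] G.M_pos by auto
  then have k: "N * (N / (1 + N)) ^ k \<le> 1"
    using G.M_pos by (simp add: field_simps)
  \<comment> \<open>Two lengths with sum at least 1 and ratio at most \<open>2 ^ k\<close> are both
    at least \<open>1 / 2 ^ (k + 1)\<close>; this is the size of the magnified halves.\<close>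
  obtain \<delta> where \<delta>: "\<delta> > 0" "\<And>x s. 1 / 2 ^ (k + 1) \<le> s \<Longrightarrow> \<delta> \<le> H (x + s) - H x"
    using quasiperiodic_bounded_below[OF H, of "1 / 2 ^ (k + 1)"] by auto
  \<comment> \<open>The \<open>H\<close>-images of the magnified halves will lie between
    \<open>\<delta>\<close> and \<open>2 * real d\<close>, so \<open>2 ^ l\<close> bounds their
    ratio.\<close>
  obtain l :: nat where l: "2 * real d \<le> 2 ^ l * \<delta>"
  proof -
    obtain l where "2 * real d / \<delta> < 2 ^ l"
      using real_arch_pow[of 2 "2 * real d / \<delta>"] by auto
    with \<delta>(1) that[of l] show ?thesis by (simp add: field_simps)
  qed
  note H_int = quasiperiodic_of_int[of H 1, OF H(3)]
  note H_le = strict_mono_less_eq[OF H(2)]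
  let ?K = "max 4 (M * (1 + M) ^ l)"
  have small: "H (x + t) - H x \<le> M * (1 + M) ^ l * (H x - H (x - t)) \<and>
      H x - H (x - t) \<le> M * (1 + M) ^ l * (H (x + t) - H x)" if t: "0 < t" "t < 1" for x t
  proof -
    \<comment> \<open>Stop at the first \<open>n\<close> at which the magnified interval reaches
      length 1.\<close>
    define P where "P n \<longleftrightarrow> (G ^^ n) (x - t) + 1 \<le> (G ^^ n) (x + t)" for n
    define n where "n = (LEAST n. P n)"
    have "\<exists>n. P n"
      unfolding P_def using t by (intro G.expansion) auto
    then have n: "P n" "\<And>j. j < n \<Longrightarrow> \<not> P j"
      unfolding n_def by (auto intro: LeastI_ex dest: not_less_Least)
    note G_less = strict_monoD[OF funpow_strict_mono[OF G.mono, of n]]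
    define y a b where "y = (G ^^ n) x" and "a = y - (G ^^ n) (x - t)" and "b = (G ^^ n) (x + t) - y"
    have ab: "0 < a" "0 < b" "1 \<le> a + b"
      using n(1) t G_less[of x "x + t"] G_less[of "x - t" x] by (auto simp: y_def a_def b_def P_def)
    \<comment> \<open>One step earlier the length was below 1, and \<open>G\<close> stretches this
      to at most \<open>d\<close>. If \<open>n = 0\<close>, the length is
      \<open>2 * t < 2\<close>.\<close>
    have ab_le: "a + b \<le> 2 * real d"
    proof (cases n)
      case 0
      then show ?thesis
        using t G.degree by (simp add: y_def a_def b_def)
    next
      case (Suc j)
      then have "\<not> P j"
        using n(2) by simp
      then have "G ((G ^^ j) (x + t)) \<le> G ((G ^^ j) (x - t) + 1)"
        by (simp add: P_def strict_mono_less_eq[OF G.mono])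
      then show ?thesis
        by (simp add: G.per Suc y_def a_def b_def)
    qed
    \<comment> \<open>\<open>G^-n\<close> sends both halves back to intervals of length
      \<open>t\<close>, so the preimage comparison applies.\<close>
    have eq: "(inv G ^^ n) (y + b) - (inv G ^^ n) y = (inv G ^^ n) y - (inv G ^^ n) (y - a)"
      by (simp add: y_def a_def b_def)
    have "b \<le> 2 ^ k * a"
      using quasisym_map_preimage_right[OF G.qs ab(2,1) k eq] .
    moreover have "a \<le> 2 ^ k * b"
      using quasisym_map_preimage_left[OF G.qs ab(2,1) k eq] .
    moreover have "a \<le> 2 ^ k * a" "b \<le> 2 ^ k * b"
      using ab by (simp_all add: mult_le_cancel_right1)
    ultimately have ab_ge: "1 / 2 ^ (k + 1) \<le> a" "1 / 2 ^ (k + 1) \<le> b"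
      using ab(3) by (simp_all add: field_simps)
    define p q u where "p = H (y + b) - H y" and "q = H y - H (y - a)" and "u = H y + of_int (e n)"
    have "\<delta> \<le> p" "\<delta> \<le> q"
      using \<delta>(2)[OF ab_ge(2), of y] \<delta>(2)[OF ab_ge(1), of "y - a"] by (auto simp: p_def q_def)
    moreover have "p \<le> 2 * real d" "q \<le> 2 * real d"
    proof -
      have "H (y + b) \<le> H (y + of_int (2 * int d))" "H (y - of_int (2 * int d)) \<le> H (y - a)"
        using ab ab_le by (simp_all add: H_le)
      then show "p \<le> 2 * real d" "q \<le> 2 * real d"
        using H_int[of y "2 * int d"] H_int[of "y - of_int (2 * int d)" "2 * int d"]
        by (simp_all add: p_def q_def)
    qed
    ultimately have pq: "0 < p" "0 < q" "p \<le> 2 ^ l * q" "q \<le> 2 ^ l * p"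
    proof -
      assume *: "\<delta> \<le> p" "\<delta> \<le> q" "p \<le> 2 * real d" "q \<le> 2 * real d"
      have "2 ^ l * \<delta> \<le> 2 ^ l * p" "2 ^ l * \<delta> \<le> 2 ^ l * q"
        using * by simp_all
      with * l \<delta>(1) show "0 < p" "0 < q" "p \<le> 2 ^ l * q" "q \<le> 2 ^ l * p"
        by linarith+
    qed
    have "H x = (inv F ^^ n) u" "H (x + t) = (inv F ^^ n) (u + p)" "H (x - t) = (inv F ^^ n) (u - q)"
      using H_eq[of x n] H_eq[of "x + t" n] H_eq[of "x - t" n]
      by (simp_all add: u_def p_def q_def a_def b_def y_def add.commute)
    then show ?thesis
      using quasisym_map_compare_right[OF F.qs pq(1-3)] quasisym_map_compare_left[OF F.qs pq(1,2,4)]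
      by simp
  qed
  have large: "H (x + t) - H x \<le> 4 * (H x - H (x - t)) \<and> H x - H (x - t) \<le> 4 * (H (x + t) - H x)"
    if t: "1 \<le> t" for x t
  proof -
    \<comment> \<open>The increment lies between \<open>\<lfloor>t\<rfloor>\<close> and
      \<open>\<lfloor>t\<rfloor> + 1\<close>; for \<open>t \<ge> 1\<close> these are within a factor
      2 of \<open>t\<close>, whence the constant 4.\<close>
    have bounds: "t / 2 \<le> H (z + t) - H z \<and> H (z + t) - H z \<le> 2 * t" for z
    proof -
      have "H (z + of_int \<lfloor>t\<rfloor>) \<le> H (z + t)" "H (z + t) \<le> H (z + of_int (\<lfloor>t\<rfloor> + 1))"
        unfolding H_le by linarith+
      then have "of_int \<lfloor>t\<rfloor> \<le> H (z + t) - H z" "H (z + t) - H z \<le> of_int \<lfloor>t\<rfloor> + 1"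
        unfolding H_int by simp_all
      moreover have "1 \<le> \<lfloor>t\<rfloor>" "of_int \<lfloor>t\<rfloor> \<le> t" "t < of_int \<lfloor>t\<rfloor> + 1"
        using t by linarith+
      ultimately show ?thesis
        by linarith
    qed
    from bounds[of x] bounds[of "x - t"] show ?thesis
      by simp
  qed
  have "quasisym_map ?K H"
    unfolding quasisym_map_def
  proof (intro conjI allI impI H(2))
    fix x t :: real
    assume t: "t > 0"
    have nonneg: "0 \<le> H x - H (x - t)" "0 \<le> H (x + t) - H x"
      using t by (simp_all add: H_le)
    have le: "4 * r \<le> ?K * r" "M * (1 + M) ^ l * r \<le> ?K * r" if "0 \<le> r" for r
      using that by (intro mult_right_mono; simp)+
    have "H (x + t) - H x \<le> ?K * (H x - H (x - t)) \<and> H x - H (x - t) \<le> ?K * (H (x + t) - H x)"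
    proof (cases "t < 1")
      case True
      then show ?thesis
        using small[OF t True, of x] le(2)[OF nonneg(1)] le(2)[OF nonneg(2)] by linarith
    next
      case False
      then show ?thesis
        using large[of t x] le(1)[OF nonneg(1)] le(1)[OF nonneg(2)] by linarith
    qed
    then show "H (x + t) - H x \<le> ?K * (H x - H (x - t))"
      and "H x - H (x - t) \<le> ?K * (H (x + t) - H x)"
      by simp_all
  qed
  then show ?thesis
    by (intro exI[of _ ?K]) auto
qed

section \<open>Passing between circle maps and lifts\<close>

lemma homeomorphism_strict_mono:
  fixes F :: "real \<Rightarrow> real"
  assumes "homeomorphism UNIV UNIV F G" "F x < F (x + 1)"
  shows "strict_mono F"
proof -
  have "inj F"
    using assms(1) by (metis UNIV_I homeomorphism_apply1 inj_on_inverseI)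
  then have "strict_mono F \<or> strict_antimono_on UNIV F"
    using injective_eq_monotone_map[of UNIV F] assms(1) by (auto simp: homeomorphism_def)
  moreover have "\<not> strict_antimono_on UNIV F"
    using assms(2) monotone_onD[of UNIV "(<)" "(>)" F x "x + 1"] by auto
  ultimately show ?thesis
    by simp
qed

lemma uniformly_symmetric_expanding_lift:
  assumes "circle_endomorphism d f" "uniformly_symmetric d f"
  obtains F M where "expanding_lift F d M" "circle_lift F f"
proof -
  obtain F \<epsilon> where F: "endomorphism_lift d f F" and bdd: "bounded (\<epsilon> ` {0::real<..})"
    and pos: "\<And>t. t > 0 \<Longrightarrow> \<epsilon> t > (0::real)"
    and ratio: "\<And>x t n. t > 0 \<Longrightarrow> n > 0 \<Longrightarrow>
      1 / (1 + \<epsilon> t) \<le> \<bar>(inv F ^^ n) (x + t) - (inv F ^^ n) x\<bar> / \<bar>(inv F ^^ n) x - (inv F ^^ n) (x - t)\<bar> \<and>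
      \<bar>(inv F ^^ n) (x + t) - (inv F ^^ n) x\<bar> / \<bar>(inv F ^^ n) x - (inv F ^^ n) (x - t)\<bar> \<le> 1 + \<epsilon> t"
    using assms(2) unfolding uniformly_symmetric_def Let_def by blast
  have d: "2 \<le> d"
    using assms(1) by (simp add: circle_endomorphism_def)
  obtain G where G: "homeomorphism UNIV UNIV F G" and F0: "F 0 = 0"
    and per: "\<And>x. F (x + 1) = F x + real d" and lift: "\<And>x. cis (2 * pi * F x) = f (cis (2 * pi * x))"
    using F by (auto simp: endomorphism_lift_def)
  have cont: "continuous_on UNIV F" and surj: "surj F"
    using G by (auto simp: homeomorphism_def)
  have mono: "strict_mono F"
    using homeomorphism_strict_mono[OF G, of 0] per[of 0] d by simp
  have "strict_mono (inv F)"
    using strict_mono_inv[OF mono surj] strict_mono_imp_inj_on[OF mono] by simp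
  then have mono_inv: "strict_mono (inv F ^^ n)" for n
    by (rule funpow_strict_mono)
  obtain C where C: "\<And>t. t > 0 \<Longrightarrow> \<epsilon> t \<le> C"
  proof -
    obtain C where "\<forall>y\<in>\<epsilon> ` {0<..}. norm y \<le> C"
      using bdd by (auto simp: bounded_iff)
    then have "\<bar>\<epsilon> t\<bar> \<le> C" if "t > 0" for t
      using that by simp
    then show ?thesis
      using that[of C] abs_le_D1 by blast
  qed
  have "C > 0"
    using C[of 1] pos[of 1] by simp
  have "quasisym_map (1 + C) (inv F ^^ n)" for n
    unfolding quasisym_map_def
  proof (intro conjI allI impI mono_inv)
    fix x t :: real
    assume t: "t > 0"
    define A B where "A = (inv F ^^ n) (x + t) - (inv F ^^ n) x"
      and "B = (inv F ^^ n) x - (inv F ^^ n) (x - t)"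
    have AB: "0 < A" "0 < B"
      using t by (simp_all add: A_def B_def strict_monoD[OF mono_inv])
    have "A \<le> (1 + C) * B \<and> B \<le> (1 + C) * A"
    \<comment> \<open>Uniform symmetry speaks of positive \<open>n\<close>; the zeroth iterate is
      the identity, with ratio 1.\<close>
    proof (cases "n = 0")
      case True
      then have "A = B"
        by (simp add: A_def B_def)
      then show ?thesis
        using AB \<open>C > 0\<close> by (simp add: mult_le_cancel_right1)
    next
      case False
      then have "1 / (1 + \<epsilon> t) \<le> A / B" "A / B \<le> 1 + \<epsilon> t"
        using ratio[OF t, of n x] AB by (simp_all add: A_def B_def)
      then have "A \<le> (1 + \<epsilon> t) * B" "B \<le> (1 + \<epsilon> t) * A"
        using AB pos[OF t] by (simp_all add: field_simps)
      moreover have "(1 + \<epsilon> t) * B \<le> (1 + C) * B" "(1 + \<epsilon> t) * A \<le> (1 + C) * A"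
        using AB C[OF t] by simp_all
      ultimately show ?thesis by linarith
    qed
    then show "(inv F ^^ n) (x + t) - (inv F ^^ n) x \<le> (1 + C) * ((inv F ^^ n) x - (inv F ^^ n) (x - t))"
      and "(inv F ^^ n) x - (inv F ^^ n) (x - t) \<le> (1 + C) * ((inv F ^^ n) (x + t) - (inv F ^^ n) x)"
      by (simp_all add: A_def B_def)
  qed
  with d cont mono surj F0 per have "expanding_lift F d (1 + C)"
    by unfold_locales
  then show ?thesis
    using lift cont by (intro that) (auto simp: circle_lift_def)
qed

lemma circle_eq_cis_image: "circle = (\<lambda>x. cis (2 * pi * x)) ` {0..1}"
proof (intro equalityI subsetI)
  fix z :: complex
  assume "z \<in> circle"
  then have "norm z = 1" "z \<noteq> 0"
    by auto
  then have z: "z = cis (Arg z)"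
    by (simp add: cis_Arg sgn_div_norm)
  let ?x = "frac (Arg z / (2 * pi))"
  have "cis (2 * pi * ?x) = cis (2 * pi * (Arg z / (2 * pi)))"
    unfolding cis_2pi_eq_iff by (simp add: frac_def)
  then have "z = cis (2 * pi * ?x)"
    using z by simp
  moreover have "?x \<in> {0..1}"
    using frac_lt_1[of "Arg z / (2 * pi)"] by simp
  ultimately show "z \<in> (\<lambda>x. cis (2 * pi * x)) ` {0..1}"
    by blast
qed auto

lemma circle_homeomorphism_of_lift:
  assumes H: "continuous_on UNIV H" "strict_mono H" "\<And>x. H (x + 1) = H x + 1"
  obtains h where "circle_homeomorphism h" "circle_lift H h"
proof -
  \<comment> \<open>The jump of \<open>Arg\<close> is harmless: \<open>H\<close> commutes with
    integer translations, so any choice of argument gives the same value.\<close>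
  define h where "h z = cis (2 * pi * H (Arg z / (2 * pi)))" for z
  note H_int = quasiperiodic_of_int[of H 1, OF H(3)]
  have lift: "h (cis (2 * pi * x)) = cis (2 * pi * H x)" for x
  proof -
    let ?y = "Arg (cis (2 * pi * x)) / (2 * pi)"
    have "cis (2 * pi * x) = cis (2 * pi * ?y)"
      using cis_Arg[of "cis (2 * pi * x)"] by (simp add: sgn_div_norm)
    then obtain k where "x - ?y = of_int k"
      unfolding cis_2pi_eq_iff by (auto elim: Ints_cases)
    then have "H x = H ?y + of_int k"
      using H_int[of ?y k] by (simp add: algebra_simps)
    then show ?thesis
      unfolding h_def cis_2pi_eq_iff[symmetric] by (subst cis_2pi_eq_iff) simp
  qed
  have Hlift: "circle_lift H h"
    using H(1) lift by (simp add: circle_lift_def)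
  obtain K where K: "homeomorphism UNIV UNIV H K"
    using real_homeomorphism_of_quasiperiodic[OF H] by blast
  have "h ` circle = circle"
  proof -
    have "z \<in> h ` circle" if "z \<in> circle" for z
    proof -
      obtain x where x: "z = cis (2 * pi * x)"
        using \<open>z \<in> circle\<close> unfolding circle_eq_cis_image by blast
      have "h (cis (2 * pi * K x)) = z"
        using K by (simp add: lift x homeomorphism_def)
      then show ?thesis
        by (metis image_eqI mem_sphere_0 norm_cis)
    qed
    then show ?thesis
      by (auto simp: h_def)
  qed
  moreover have "inj_on h circle"
  proof (rule inj_onI)
    fix z w
    assume zw: "z \<in> circle" "w \<in> circle" "h z = h w"
    obtain x where x: "z = cis (2 * pi * x)"
      using zw(1) unfolding circle_eq_cis_image by blast
    obtain y where y: "w = cis (2 * pi * y)"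
      using zw(2) unfolding circle_eq_cis_image by blast
    have "H x - H y \<in> \<int>"
      using zw(3) unfolding x y lift cis_2pi_eq_iff .
    then obtain k where "H x = H (y + of_int k)"
      by (auto simp: H_int elim!: Ints_cases) (metis add.commute diff_add_cancel)
    then have "x = y + of_int k"
      using strict_mono_eq[OF H(2)] by blast
    then show "z = w"
      unfolding x y cis_2pi_eq_iff by simp
  qed
  moreover have "continuous_on circle h"
  proof -
    \<comment> \<open>Since \<open>Arg\<close> jumps, continuity is obtained through a quotient:
      \<open>?p\<close> maps a compact interval onto a Hausdorff space, so \<open>h\<close> is
      continuous as soon as \<open>h \<circ> ?p\<close> is.\<close>
    let ?p = "\<lambda>x. cis (2 * pi * x)"
    have "continuous_map (top_of_set {0..1}) (top_of_set circle) ?p"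
      by (auto intro!: continuous_intros)
    then have "quotient_map (top_of_set {0..1}) (top_of_set circle) ?p"
      by (intro continuous_imp_quotient_map)
         (auto simp: compact_space_subtopology Hausdorff_space_subtopology circle_eq_cis_image[symmetric])
    moreover have "continuous_map (top_of_set {0..1}) euclidean (h \<circ> ?p)"
      using H(1) by (auto simp: o_def lift intro!: continuous_intros continuous_on_compose2[OF H(1)])
    ultimately have "continuous_map (top_of_set circle) euclidean h"
      by (rule continuous_compose_quotient_map)
    then show ?thesis
      by simp
  qed
  ultimately have "\<exists>k. homeomorphism circle circle h k"
    by (intro homeomorphism_compact) auto
  then have "circle_homeomorphism h"
    using Hlift H(2) by (auto simp: circle_homeomorphism_def orientation_preserving_def)
  from that[OF this Hlift] show ?thesis .
qed

section \<open>Conjugacy and quasisymmetry on the circle\<close>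

theorem corollary1:
  fixes f g :: "complex \<Rightarrow> complex" and d :: nat
  assumes "circle_endomorphism d f" and "uniformly_symmetric d f"
    and "circle_endomorphism d g" and "uniformly_symmetric d g"
  shows "topologically_conjugate f g \<and> (\<forall>h. conjugacy h f g \<longrightarrow> quasisymmetric h)"
proof (intro conjI allI impI)
  obtain F M where F: "expanding_lift F d M" "circle_lift F f"
    using uniformly_symmetric_expanding_lift[OF assms(1,2)] .
  obtain G N where G: "expanding_lift G d N" "circle_lift G g"
    using uniformly_symmetric_expanding_lift[OF assms(3,4)] .
  show "topologically_conjugate f g"
  proof -
    obtain H where H: "continuous_on UNIV H" "strict_mono H" "\<And>x. H (x + 1) = H x + 1"
      and conj: "\<And>x. F (H x) = H (G x)"
      using conjugating_lift_exists[OF F(1) G(1)] by blast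
    obtain h where h: "circle_homeomorphism h" "circle_lift H h"
      using circle_homeomorphism_of_lift[OF H] .
    have "f (h z) = h (g z)" if z: "z \<in> circle" for z
    proof -
      obtain x where x: "z = cis (2 * pi * x)"
        using z unfolding circle_eq_cis_image by blast
      show ?thesis
        using F(2) G(2) h(2) conj[of x] unfolding x circle_lift_def by metis
    qed
    with h(1) show ?thesis
      by (auto simp: topologically_conjugate_def conjugacy_def)
  qed
  fix h
  assume "conjugacy h f g"
  then have h: "circle_homeomorphism h" and fh: "\<And>z. z \<in> circle \<Longrightarrow> f (h z) = h (g z)"
    by (auto simp: conjugacy_def)
  obtain H where H: "homeomorphism_lift h H"
    using homeomorphism_lift_ex1[OF h] by blast
  then obtain K where K: "homeomorphism UNIV UNIV H K" and per: "\<And>x. H (x + 1) = H x + 1"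
    and lift: "\<And>x. cis (2 * pi * H x) = h (cis (2 * pi * x))"
    by (auto simp: homeomorphism_lift_def)
  have cont: "continuous_on UNIV H"
    using K by (simp add: homeomorphism_def)
  have mono: "strict_mono H"
    using homeomorphism_strict_mono[OF K, of 0] per[of 0] by simp
  \<comment> \<open>Both sides lift the circle map \<open>f o h = h o g\<close>, so they differ by
    an integer, possibly nonzero because \<open>h\<close> may move the fixed point 1.\<close>
  have "circle_lift (\<lambda>x. F (H x)) (\<lambda>z. f (h z))" "circle_lift (\<lambda>x. H (G x)) (\<lambda>z. f (h z))"
    using F(2) G(2) cont by (auto simp: circle_lift_def lift fh intro: continuous_on_compose2)
  then obtain m where "\<And>x. F (H x) = H (G x) + of_int m"
    using lifts_differ_by_int by blast
  then obtain L where L: "L \<ge> 1" "quasisym_map L H"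
    using conjugating_lift_quasisym[OF F(1) G(1) cont mono per] by blast
  have "inverse L \<le> \<bar>H (x + t) - H x\<bar> / \<bar>H x - H (x - t)\<bar> \<and>
      \<bar>H (x + t) - H x\<bar> / \<bar>H x - H (x - t)\<bar> \<le> L" if t: "t > 0" for x t
  proof -
    have "0 < H (x + t) - H x" "0 < H x - H (x - t)"
      using t by (simp_all add: strict_monoD[OF mono])
    then show ?thesis
      using quasisym_mapD[OF L(2) t, of x] L(1) by (simp add: field_simps)
  qed
  with h H L(1) show "quasisymmetric h"
    unfolding quasisymmetric_def by blast
qed

end
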